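(* Let $(M,\xi)$ be a smooth contact 3-manifold. For continuous embedded curves in $M$ and for continuous isotopies of such curves, the projection definition and the angle definition of "Legendrian" given in the context are equivalent: a continuous curve is Legendrian in the sense of the projection definition if and only if it is Legendrian in the sense of the angle definition, and a continuous isotopy is Legendrian in the sense of the projection definition if and only if it is Legendrian in the sense of the angle definition.
   Context: A contact structure $\xi$ on a smooth 3-manifold is a 2-plane distribution that is locally the kernel of a smooth 1-form $\alpha$ with $\alpha\wedge d\alpha\ne0$ everywhere; $\xi_p$ is the plane at $p$. Curves are embedded: subsets homeomorphic to connected subsets of a circle. "Euclidean coordinates of class $C^1$" in a neighborhood of $p$ means a $C^1$ chart to an open subset of Euclidean space $\mathbb R^3$; orthogonal projections, differences of points and angles are computed in the chart. Projection definition. A continuous curve $L$ is Legendrian if for any $p\in L$ and any Euclidean coordinates of class $C^1$ in a neighborhood of $p$ there is a smaller neighborhood $U\ni p$ such that the orthogonal projection to the contact plane at $p$ is injective on $L\cap U$. A continuous isotopy $\{L_t\}_{t\in[0;1]}$ of Legendrian curves is Legendrian if for any $t_0\in[0;1]$, any $p\in L_{t_0}$ and any Euclidean coordinates of class $C^1$ in a neighborhood of $p$ there are a smaller neighborhood $U\ni p$ and an interval $I\ni t_0$ such that for any $t\in I$ the orthogonal projection to the contact plane at $p$ is injective on $L_t\cap U$. Angle definition. A continuous curve $L$ is Legendrian if for any $p\in L$ and any (equivalently some) Euclidean coordinates of class $C^1$ in a neighborhood of $p$: for any $\varepsilon>0$ there is a smaller neighborhood $U\ni p$ such that $\angle(p''-p',\xi_p)<\varepsilon$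 for any two distinct points $p',p''\in L\cap U$. A continuous isotopy $\{L_t\}_{t\in[0;1]}$ of Legendrian curves is Legendrian if for any $t_0\in[0;1]$, any $p\in L_{t_0}$ and any (equivalently some) Euclidean coordinates of class $C^1$ in a neighborhood of $p$: for any $\varepsilon>0$ there are a smaller neighborhood $U\ni p$ and an interval $I\ni t_0$ such that $\angle(p''-p',\xi_p)<\varepsilon$ for any $t\in I$ and any two distinct points $p',p''\in L_t\cap U$. In both definitions an interval $I\ni t_0$ is a neighborhood of $t_0$ in $[0;1]$. *)

theory Defs
  imports "HOL-Analysis.Analysis"
begin

section \<open>Smooth 3-manifolds\<close>

text \<open>
  \<^term>\<open>f\<close> is of class \<open>C\<close>-\<^term>\<open>k\<close> on the open set \<^term>\<open>S\<close>. For a finite-dimensional domain, iterating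
  over directional derivatives is the same as iterating over total derivatives, and it avoids
  a change of type at each step. The set \<^term>\<open>S\<close> is meant to be open.
\<close>

primrec Ck_on :: "nat \<Rightarrow> 'a::real_normed_vector set \<Rightarrow> ('a \<Rightarrow> 'b::real_normed_vector) \<Rightarrow> bool" where
  "Ck_on 0 S f \<longleftrightarrow> continuous_on S f"
| "Ck_on (Suc k) S f \<longleftrightarrow>
     (\<forall>x\<in>S. f differentiable (at x)) \<and> (\<forall>v. Ck_on k S (\<lambda>x. frechet_derivative f (at x) v))"

definition smooth_on :: "'a::real_normed_vector set \<Rightarrow> ('a \<Rightarrow> 'b::real_normed_vector) \<Rightarrow> bool" where
  "smooth_on S f \<longleftrightarrow> (\<forall>k. Ck_on k S f)"

text \<open>A chart is a pair of a domain and a map; the values of the map off the domain are irrelevant.\<close>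

type_synonym 'm chart = "'m set \<times> ('m \<Rightarrow> real^3)"

definition top_chart :: "'m topology \<Rightarrow> 'm chart \<Rightarrow> bool" where
  "top_chart X c \<longleftrightarrow> openin X (fst c) \<and> open (snd c ` fst c) \<and>
     homeomorphic_map (subtopology X (fst c)) (top_of_set (snd c ` fst c)) (snd c)"

definition chart_inv :: "'m chart \<Rightarrow> real^3 \<Rightarrow> 'm" where
  "chart_inv c = inv_into (fst c) (snd c)"

text \<open>The change of coordinates from \<^term>\<open>c\<close> to \<^term>\<open>d\<close>, meaningful on \<^term>\<open>snd c ` (fst c \<inter> fst d)\<close>.\<close>

definition transition :: "'m chart \<Rightarrow> 'm chart \<Rightarrow> real^3 \<Rightarrow> real^3" where
  "transition c d = snd d \<circ> chart_inv c"

definition Ck_compatible :: "nat \<Rightarrow> 'm chart \<Rightarrow> 'm chart \<Rightarrow> bool" where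
  "Ck_compatible k c d \<longleftrightarrow>
     Ck_on k (snd c ` (fst c \<inter> fst d)) (transition c d) \<and>
     Ck_on k (snd d ` (fst c \<inter> fst d)) (transition d c)"

definition smooth_compatible :: "'m chart \<Rightarrow> 'm chart \<Rightarrow> bool" where
  "smooth_compatible c d \<longleftrightarrow> (\<forall>k. Ck_compatible k c d)"

text \<open>The atlas \<^term>\<open>A\<close> need not be maximal.\<close>

definition smooth_3_manifold :: "'m topology \<Rightarrow> 'm chart set \<Rightarrow> bool" where
  "smooth_3_manifold X A \<longleftrightarrow>
     Hausdorff_space X \<and> second_countable X \<and>
     (\<forall>c\<in>A. top_chart X c) \<and> topspace X = \<Union> (fst ` A) \<and>
     (\<forall>c\<in>A. \<forall>d\<in>A. smooth_compatible c d)"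

definition smooth_charts :: "'m topology \<Rightarrow> 'm chart set \<Rightarrow> 'm chart set" where
  "smooth_charts X A = {c. top_chart X c \<and> (\<forall>a\<in>A. smooth_compatible c a)}"

definition C1_charts :: "'m topology \<Rightarrow> 'm chart set \<Rightarrow> 'm chart set" where
  "C1_charts X A = {c. top_chart X c \<and> (\<forall>a\<in>A. Ck_compatible 1 c a)}"

definition C1_charts_at :: "'m topology \<Rightarrow> 'm chart set \<Rightarrow> 'm \<Rightarrow> 'm chart set" where
  "C1_charts_at X A p = {c \<in> C1_charts X A. p \<in> fst c}"


section \<open>Tangent vectors\<close>

text \<open>
  A tangent vector at a point is given by its coordinates in all charts around the point,
  subject to the transformation law. Since a \<open>C1\<close> structure is enough for this, the index set
  consists of all \<open>C1\<close> charts; hence for a \<open>C1\<close> chart \<^term>\<open>c\<close> and a tangent vector \<^term>\<open>v\<close> at a point of its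
  domain, \<^term>\<open>v c\<close> is the image of \<^term>\<open>v\<close> under the differential of \<^term>\<open>c\<close>. At other indices
  the value is fixed to 0, so that equality of tangent vectors is equality of functions.
\<close>

type_synonym 'm tvec = "'m chart \<Rightarrow> real^3"

definition tangent_space :: "'m topology \<Rightarrow> 'm chart set \<Rightarrow> 'm \<Rightarrow> 'm tvec set" where
  "tangent_space X A p =
     {v. (\<forall>c \<in> C1_charts_at X A p. \<forall>d \<in> C1_charts_at X A p.
            v d = frechet_derivative (transition c d) (at (snd c p)) (v c)) \<and>
         (\<forall>c. c \<notin> C1_charts_at X A p \<longrightarrow> v c = 0)}"

text \<open>The tangent vector at \<^term>\<open>p\<close> whose coordinates in the chart \<^term>\<open>c\<close> are \<^term>\<open>e\<close>.\<close>

definition coord_vec :: "'m topology \<Rightarrow> 'm chart set \<Rightarrow> 'm chart \<Rightarrow> 'm \<Rightarrow> real^3 \<Rightarrow> 'm tvec" where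
  "coord_vec X A c p e =
     (\<lambda>d. if d \<in> C1_charts_at X A p
          then frechet_derivative (transition c d) (at (snd c p)) e else 0)"


section \<open>Contact structures\<close>

type_synonym 'm one_form = "'m \<Rightarrow> 'm tvec \<Rightarrow> real"

text \<open>The coefficients of \<open>\<alpha> = a\<^sub>1 dx\<^sub>1 + a\<^sub>2 dx\<^sub>2 + a\<^sub>3 dx\<^sub>3\<close> in the chart \<^term>\<open>c\<close>.\<close>

definition form_coeffs ::
  "'m topology \<Rightarrow> 'm chart set \<Rightarrow> 'm one_form \<Rightarrow> 'm chart \<Rightarrow> real^3 \<Rightarrow> real^3" where
  "form_coeffs X A \<alpha> c x = (\<chi> i. \<alpha> (chart_inv c x) (coord_vec X A c (chart_inv c x) (axis i 1)))"

definition smooth_one_form_on ::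
  "'m topology \<Rightarrow> 'm chart set \<Rightarrow> 'm set \<Rightarrow> 'm one_form \<Rightarrow> bool" where
  "smooth_one_form_on X A W \<alpha> \<longleftrightarrow>
     (\<forall>p\<in>W. \<forall>u \<in> tangent_space X A p. \<forall>v \<in> tangent_space X A p. \<forall>r s.
        \<alpha> p (\<lambda>c. r *\<^sub>R u c + s *\<^sub>R v c) = r * \<alpha> p u + s * \<alpha> p v) \<and>
     (\<forall>c \<in> smooth_charts X A. smooth_on (snd c ` (fst c \<inter> W)) (form_coeffs X A \<alpha> c))"

text \<open>
  In coordinates, \<open>d(\<Sum>j. a\<^sub>j dx\<^sub>j) (u, v) = (\<Sum>i j. \<partial>\<^sub>i a\<^sub>j (u\<^sub>i v\<^sub>j - v\<^sub>i u\<^sub>j))\<close>.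
\<close>

definition ext_deriv :: "(real^3 \<Rightarrow> real^3) \<Rightarrow> real^3 \<Rightarrow> real^3 \<Rightarrow> real^3 \<Rightarrow> real" where
  "ext_deriv a x u v = frechet_derivative a (at x) u \<bullet> v - frechet_derivative a (at x) v \<bullet> u"

definition wedge_1_2 ::
  "('v \<Rightarrow> real) \<Rightarrow> ('v \<Rightarrow> 'v \<Rightarrow> real) \<Rightarrow> 'v \<Rightarrow> 'v \<Rightarrow> 'v \<Rightarrow> real" where
  "wedge_1_2 \<alpha> \<beta> u v w = \<alpha> u * \<beta> v w + \<alpha> v * \<beta> w u + \<alpha> w * \<beta> u v"

text \<open>\<open>\<alpha> \<and> d\<alpha>\<close> does not vanish at any point of \<^term>\<open>W\<close>.\<close>

definition contact_form_on ::
  "'m topology \<Rightarrow> 'm chart set \<Rightarrow> 'm set \<Rightarrow> 'm one_form \<Rightarrow> bool" where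
  "contact_form_on X A W \<alpha> \<longleftrightarrow>
     smooth_one_form_on X A W \<alpha> \<and>
     (\<forall>c \<in> smooth_charts X A. \<forall>q \<in> fst c \<inter> W. \<exists>u v w.
        wedge_1_2 ((\<bullet>) (form_coeffs X A \<alpha> c (snd c q)))
                  (ext_deriv (form_coeffs X A \<alpha> c) (snd c q)) u v w \<noteq> 0)"

text \<open>The image in \<open>\<real>\<^sup>3\<close> of the plane \<^term>\<open>\<xi> p\<close> under the differential at \<^term>\<open>p\<close> of the \<open>C1\<close> chart \<^term>\<open>c\<close>.\<close>

definition plane_in_chart :: "('m \<Rightarrow> 'm tvec set) \<Rightarrow> 'm \<Rightarrow> 'm chart \<Rightarrow> (real^3) set" where
  "plane_in_chart \<xi> p c = (\<lambda>v. v c) ` \<xi> p"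

definition plane_distribution ::
  "'m topology \<Rightarrow> 'm chart set \<Rightarrow> ('m \<Rightarrow> 'm tvec set) \<Rightarrow> bool" where
  "plane_distribution X A \<xi> \<longleftrightarrow>
     (\<forall>p \<in> topspace X. \<xi> p \<subseteq> tangent_space X A p \<and>
        (\<forall>c \<in> C1_charts_at X A p.
           subspace (plane_in_chart \<xi> p c) \<and> dim (plane_in_chart \<xi> p c) = 2))"

definition contact_structure ::
  "'m topology \<Rightarrow> 'm chart set \<Rightarrow> ('m \<Rightarrow> 'm tvec set) \<Rightarrow> bool" where
  "contact_structure X A \<xi> \<longleftrightarrow>
     plane_distribution X A \<xi> \<and>
     (\<forall>p \<in> topspace X. \<exists>W \<alpha>. openin X W \<and> p \<in> W \<and> contact_form_on X A W \<alpha> \<and>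
        (\<forall>q\<in>W. \<xi> q = {v \<in> tangent_space X A q. \<alpha> q v = 0}))"

definition contact_3_manifold ::
  "'m topology \<Rightarrow> 'm chart set \<Rightarrow> ('m \<Rightarrow> 'm tvec set) \<Rightarrow> bool" where
  "contact_3_manifold X A \<xi> \<longleftrightarrow> smooth_3_manifold X A \<and> contact_structure X A \<xi>"


section \<open>Curves and isotopies\<close>

definition embedded_curve :: "'m topology \<Rightarrow> 'm set \<Rightarrow> bool" where
  "embedded_curve X L \<longleftrightarrow> L \<subseteq> topspace X \<and>
     (\<exists>C \<subseteq> sphere (0::complex) 1. connected C \<and> subtopology X L homeomorphic_space top_of_set C)"

text \<open>
  A continuous isotopy is a family of images of one connected subset \<open>C\<close> of the circle
  under embeddings that depend continuously on the parameter.
\<close>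

definition curve_isotopy :: "'m topology \<Rightarrow> (real \<Rightarrow> 'm set) \<Rightarrow> bool" where
  "curve_isotopy X L \<longleftrightarrow>
     (\<exists>C \<subseteq> sphere (0::complex) 1. \<exists>F. connected C \<and>
        continuous_map (prod_topology (top_of_set {0..1::real}) (top_of_set C)) X (\<lambda>(t, s). F t s) \<and>
        (\<forall>t\<in>{0..1}. embedding_map (top_of_set C) X (F t) \<and> L t = F t ` C))"


section \<open>Legendrian curves and isotopies\<close>

definition orth_proj :: "(real^3) set \<Rightarrow> real^3 \<Rightarrow> real^3" where
  "orth_proj P x = (THE y. y \<in> P \<and> (\<forall>z\<in>P. orthogonal (x - y) z))"

definition vec_angle :: "real^3 \<Rightarrow> real^3 \<Rightarrow> real" where
  "vec_angle u v = arccos (u \<bullet> v / (norm u * norm v))"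

text \<open>The angle between a nonzero vector and a plane: the least angle with a nonzero vector of the plane.\<close>

definition plane_angle :: "real^3 \<Rightarrow> (real^3) set \<Rightarrow> real" where
  "plane_angle u P = (INF w \<in> P - {0}. vec_angle u w)"

text \<open>
  Planes here are linear subspaces. Projecting to the parallel affine plane through the point
  \<^term>\<open>snd c p\<close> instead changes the projection by a translation only, so injectivity is not affected.
\<close>

definition proj_legendrian_curve ::
  "'m topology \<Rightarrow> 'm chart set \<Rightarrow> ('m \<Rightarrow> 'm tvec set) \<Rightarrow> 'm set \<Rightarrow> bool" where
  "proj_legendrian_curve X A \<xi> L \<longleftrightarrow>
     (\<forall>p\<in>L. \<forall>c \<in> C1_charts_at X A p. \<exists>U. openin X U \<and> p \<in> U \<and> U \<subseteq> fst c \<and>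
        inj_on (\<lambda>q. orth_proj (plane_in_chart \<xi> p c) (snd c q)) (L \<inter> U))"

definition angle_legendrian_curve ::
  "'m topology \<Rightarrow> 'm chart set \<Rightarrow> ('m \<Rightarrow> 'm tvec set) \<Rightarrow> 'm set \<Rightarrow> bool" where
  "angle_legendrian_curve X A \<xi> L \<longleftrightarrow>
     (\<forall>p\<in>L. \<forall>c \<in> C1_charts_at X A p. \<forall>\<epsilon>>0. \<exists>U. openin X U \<and> p \<in> U \<and> U \<subseteq> fst c \<and>
        (\<forall>p' \<in> L \<inter> U. \<forall>p'' \<in> L \<inter> U. p' \<noteq> p'' \<longrightarrow>
           plane_angle (snd c p'' - snd c p') (plane_in_chart \<xi> p c) < \<epsilon>))"

text \<open>Open intervals of \<open>[0;1]\<close> containing the given parameter; these may contain an end point of \<open>[0;1]\<close>.\<close>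

definition nbhd_interval :: "real \<Rightarrow> real set \<Rightarrow> bool" where
  "nbhd_interval t0 I \<longleftrightarrow> is_interval I \<and> openin (top_of_set {0..1}) I \<and> t0 \<in> I"

definition proj_legendrian_isotopy ::
  "'m topology \<Rightarrow> 'm chart set \<Rightarrow> ('m \<Rightarrow> 'm tvec set) \<Rightarrow> (real \<Rightarrow> 'm set) \<Rightarrow> bool" where
  "proj_legendrian_isotopy X A \<xi> L \<longleftrightarrow>
     (\<forall>t\<in>{0..1}. proj_legendrian_curve X A \<xi> (L t)) \<and>
     (\<forall>t0\<in>{0..1}. \<forall>p \<in> L t0. \<forall>c \<in> C1_charts_at X A p.
        \<exists>U I. openin X U \<and> p \<in> U \<and> U \<subseteq> fst c \<and> nbhd_interval t0 I \<and>
          (\<forall>t\<in>I. inj_on (\<lambda>q. orth_proj (plane_in_chart \<xi> p c) (snd c q)) (L t \<inter> U)))"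

definition angle_legendrian_isotopy ::
  "'m topology \<Rightarrow> 'm chart set \<Rightarrow> ('m \<Rightarrow> 'm tvec set) \<Rightarrow> (real \<Rightarrow> 'm set) \<Rightarrow> bool" where
  "angle_legendrian_isotopy X A \<xi> L \<longleftrightarrow>
     (\<forall>t\<in>{0..1}. angle_legendrian_curve X A \<xi> (L t)) \<and>
     (\<forall>t0\<in>{0..1}. \<forall>p \<in> L t0. \<forall>c \<in> C1_charts_at X A p. \<forall>\<epsilon>>0.
        \<exists>U I. openin X U \<and> p \<in> U \<and> U \<subseteq> fst c \<and> nbhd_interval t0 I \<and>
          (\<forall>t\<in>I. \<forall>p' \<in> L t \<inter> U. \<forall>p'' \<in> L t \<inter> U. p' \<noteq> p'' \<longrightarrow>
             plane_angle (snd c p'' - snd c p') (plane_in_chart \<xi> p c) < \<epsilon>))"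

end

theory Submission
  imports Defs
begin

text \<open>
  A chord orthogonal to the plane makes the angle \<open>\<pi>/2\<close> with it, so the angle condition for
  \<open>\<epsilon> = \<pi>/2\<close> gives injectivity of the projection in the same neighborhood.

  Conversely, suppose that in some chart there are chords with end points converging to \<open>p\<close> whose
  angle with the plane \<open>P\<close> stays at least \<open>\<epsilon>\<close>. Then the slopes of these chords relative to \<open>P\<close>
  (horizontal displacement divided by height difference) are bounded, and a subsequence of them
  converges. One can therefore find a \<open>C\<^sup>1\<close> map \<open>H\<close> from the height axis to \<open>P\<close> whose increments
  between the heights of the end points are exactly the horizontal displacements, for infinitely
  many of the chords. The shear that subtracts \<open>H\<close> of the height is a \<open>C\<^sup>1\<close> change of coordinates
  that preserves \<open>P\<close> and makes these chords orthogonal to \<open>P\<close>, so the projection is not injective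
  near \<open>p\<close> in the new chart.
\<close>

section \<open>Prescribing increments of a \<open>C\<^sup>1\<close> function of one variable\<close>

text \<open>The square of a positive part is of class C^1 with an explicit derivative, which is all
  the interpolation asks for. For \<open>\<rho> > 0\<close> it is 1 at \<open>q\<close> and vanishes
  at distance \<open>\<rho>\<close> or more from \<open>q\<close>.\<close>

definition bump :: "real \<Rightarrow> real \<Rightarrow> real \<Rightarrow> real" where
  "bump q \<rho> z = (max 0 (1 - ((z - q) / \<rho>)\<^sup>2))\<^sup>2"

definition bump_deriv :: "real \<Rightarrow> real \<Rightarrow> real \<Rightarrow> real" where
  "bump_deriv q \<rho> z = - 4 * ((z - q) / \<rho>\<^sup>2) * max 0 (1 - ((z - q) / \<rho>)\<^sup>2)"

text \<open>Away from 0 the function is locally either 0 or the square; at 0 the difference quotient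
  is at most \<open>\<bar>h\<bar>\<close> in absolute value.\<close>

lemma DERIV_max_0_square: "((\<lambda>x::real. (max 0 x)\<^sup>2) has_real_derivative 2 * max 0 x) (at x)"
proof (cases x "0::real" rule: linorder_cases)
  case less
  have "((\<lambda>x::real. 0) has_real_derivative 2 * max 0 x) (at x)"
    using less by simp
  then show ?thesis
    by (rule DERIV_cong_ev[THEN iffD1, rotated -1, of _ _ _ x])
      (use less eventually_nhds_in_open[of "{..<0}" x] in \<open>auto elim!: eventually_mono\<close>)
next
  case greater
  have "((\<lambda>x::real. x\<^sup>2) has_real_derivative 2 * max 0 x) (at x)"
    using greater by (auto intro!: derivative_eq_intros)
  then show ?thesis
    by (rule DERIV_cong_ev[THEN iffD1, rotated -1, of _ _ _ x])
      (use greater eventually_nhds_in_open[of "{0<..}" x] in \<open>auto elim!: eventually_mono\<close>)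
next
  case equal
  have "((\<lambda>h::real. (max 0 h)\<^sup>2 / h) \<longlongrightarrow> 0) (at 0)"
  proof (rule Lim_null_comparison)
    show "\<forall>\<^sub>F h::real in at 0. norm ((max 0 h)\<^sup>2 / h) \<le> \<bar>h\<bar>"
      by (intro always_eventually allI) (simp add: max_def power2_eq_square)
  qed (auto intro!: tendsto_eq_intros)
  with equal show ?thesis
    by (simp add: has_field_derivative_iff)
qed

lemma DERIV_bump:
  assumes "\<rho> > 0"
  shows "(bump q \<rho> has_real_derivative bump_deriv q \<rho> z) (at z)"
proof -
  have "((\<lambda>z. 1 - ((z - q) / \<rho>)\<^sup>2) has_real_derivative - 2 * ((z - q) / \<rho>\<^sup>2)) (at z)"
    using assms by (auto intro!: derivative_eq_intros simp: field_simps power2_eq_square)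
  from DERIV_chain2[OF DERIV_max_0_square this] show ?thesis
    unfolding bump_def[abs_def] by (rule DERIV_cong) (simp add: bump_deriv_def)
qed

lemma continuous_on_bump_deriv: "continuous_on S (bump_deriv q \<rho>)"
  unfolding bump_deriv_def[abs_def] divide_inverse by (intro continuous_intros)

lemma bump_self [simp]: "bump q \<rho> q = 1"
  by (simp add: bump_def)

lemma bump_eq_0: 
  assumes "\<rho> > 0" "\<bar>z - q\<bar> \<ge> \<rho>" shows "bump q \<rho> z = 0"
proof -
  have "\<bar>(z - q) / \<rho>\<bar> \<ge> 1" using assms by simp
  then have "((z - q) / \<rho>)\<^sup>2 \<ge> 1" by (metis abs_le_square_iff abs_one one_power2)
  then show ?thesis by (simp add: bump_def)
qed

text \<open>Inside the support \<open>\<bar>z - q\<bar> / \<rho>\<^sup>2\<close> is at most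
  \<open>1 / \<rho>\<close> and the positive part is at most 1; outside, the derivative is 0. The
  bound is uniform in \<open>z\<close>, as the Weierstrass test requires.\<close>

lemma abs_bump_deriv_le:
  assumes "\<rho> > 0" shows "\<bar>bump_deriv q \<rho> z\<bar> \<le> 4 / \<rho>"
proof (cases "\<bar>z - q\<bar> \<ge> \<rho>")
  case True
  have "\<bar>(z - q) / \<rho>\<bar> \<ge> 1" using assms True by simp
  then have "((z - q) / \<rho>)\<^sup>2 \<ge> 1" by (metis abs_le_square_iff abs_one one_power2)
  then show ?thesis using assms by (simp add: bump_deriv_def)
next
  case False
  have "\<bar>z - q\<bar> / \<rho>\<^sup>2 \<le> 1 / \<rho>"
    using assms False by (simp add: field_simps power2_eq_square)
  moreover have "\<bar>max 0 (1 - ((z - q) / \<rho>)\<^sup>2)\<bar> \<le> 1"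
    by simp
  ultimately have "(\<bar>z - q\<bar> / \<rho>\<^sup>2) * \<bar>max 0 (1 - ((z - q) / \<rho>)\<^sup>2)\<bar> \<le> 1 / \<rho> * 1"
    using assms by (intro mult_mono) auto
  then have "4 * ((\<bar>z - q\<bar> / \<rho>\<^sup>2) * \<bar>max 0 (1 - ((z - q) / \<rho>)\<^sup>2)\<bar>) \<le> 4 / \<rho>"
    by simp
  then show ?thesis
    unfolding bump_deriv_def abs_mult abs_divide by (simp only: mult.assoc) simp
qed

text \<open>By \<open>small\<close>, the derivatives of the terms are at most
  \<open>4 * (1/2) ^ k\<close>, so their series converges uniformly to a continuous function.
  Termwise differentiation also asks for one point of convergence; at \<open>z0\<close> all terms
  vanish.\<close>

lemma C1_scaled_bump_series:
  fixes v :: "nat \<Rightarrow> 'a::banach"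
  assumes \<rho>: "\<And>k. \<rho> k > 0"
    and small: "\<And>k. norm (v k) / \<rho> k \<le> (1/2) ^ k"
    and z0: "\<And>k. bump (q k) (\<rho> k) z0 = 0"
  obtains g g' where
    "\<And>z. (\<lambda>k. bump (q k) (\<rho> k) z *\<^sub>R v k) sums g z"
    "\<And>z. (g has_vector_derivative g' z) (at z)"
    "continuous_on UNIV g'"
proof -
  define f where "f k z = bump (q k) (\<rho> k) z *\<^sub>R v k" for k z
  define f' where "f' k z = bump_deriv (q k) (\<rho> k) z *\<^sub>R v k" for k z
  define g' where "g' z = (\<Sum>k. f' k z)" for z
  have bound: "norm (f' k z) \<le> 4 * (1/2) ^ k" for k z
  proof -
    have "norm (f' k z) \<le> 4 / \<rho> k * norm (v k)"
      unfolding f'_def norm_scaleR real_norm_def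
      by (intro mult_right_mono abs_bump_deriv_le \<rho> norm_ge_zero)
    also have "\<dots> = 4 * (norm (v k) / \<rho> k)" by simp
    also have "\<dots> \<le> 4 * (1/2) ^ k" using small[of k] by linarith
    finally show ?thesis .
  qed
  have unif: "uniform_limit UNIV (\<lambda>n z. \<Sum>k<n. f' k z) g' sequentially"
    unfolding g'_def[abs_def]
    by (rule Weierstrass_m_test[where M = "\<lambda>k. 4 * (1/2) ^ k"])
      (use bound in \<open>auto intro!: summable_mult summable_geometric\<close>)
  have cont: "continuous_on UNIV g'"
    by (rule uniform_limit_theorem[OF always_eventually unif])
      (auto simp: f'_def intro!: continuous_intros continuous_on_bump_deriv)
  have "\<exists>g. \<forall>z\<in>UNIV. (\<lambda>k. f k z) sums g z \<and> (g has_derivative (\<lambda>h. h *\<^sub>R g' z)) (at z within UNIV)"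
  proof (rule has_derivative_series[where f' = "\<lambda>k z h. h *\<^sub>R f' k z" and x = z0])
    show "(f k has_derivative (\<lambda>h. h *\<^sub>R f' k z)) (at z within UNIV)" for k z
    proof -
      have "(f k has_vector_derivative f' k z) (at z)"
        unfolding f_def[abs_def] f'_def
        using DERIV_bump[OF \<rho>]
        by (auto intro!: derivative_eq_intros)
      then show ?thesis by (simp add: has_vector_derivative_def)
    qed
    show "\<forall>\<^sub>F n in sequentially. \<forall>x\<in>UNIV. \<forall>h.
         norm ((\<Sum>i<n. h *\<^sub>R f' i x) - h *\<^sub>R g' x) \<le> e * norm h" if "e > 0" for e
      using uniform_limitD[OF unif that]
    proof eventually_elim
      case (elim n)
      have "norm ((\<Sum>i<n. h *\<^sub>R f' i x) - h *\<^sub>R g' x) \<le> e * norm h" for x h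
      proof -
        have "(\<Sum>i<n. h *\<^sub>R f' i x) - h *\<^sub>R g' x = h *\<^sub>R ((\<Sum>i<n. f' i x) - g' x)"
          by (simp add: scaleR_sum_right scaleR_diff_right)
        moreover have "norm ((\<Sum>i<n. f' i x) - g' x) \<le> e"
          using elim by (auto simp: dist_norm less_imp_le)
        ultimately show ?thesis
          by (simp add: mult_left_mono mult.commute[of e])
      qed
      then show ?case by blast
    qed
    show "(\<lambda>k. f k z0) sums 0" by (simp add: f_def z0)
  qed auto
  then obtain g where "\<And>z. (\<lambda>k. f k z) sums g z"
     "\<And>z. (g has_derivative (\<lambda>h. h *\<^sub>R g' z)) (at z)" by auto
  with cont show ?thesis
    by (intro that[of g g']) (auto simp: f_def has_vector_derivative_def)
qed

text \<open>
  The map is \<open>z \<mapsto> z a\<close> plus a series of bumps centred at the \<open>t n\<close>. Along a subsequence that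
  converges fast enough, each bump vanishes at all other prescribed points, and the derivatives are
  summable because \<open>w n - (t n - s n) a\<close> is small compared with \<open>t n - s n\<close>.
\<close>

lemma C1_interpolation_ordered:
  fixes s t :: "nat \<Rightarrow> real" and w :: "nat \<Rightarrow> 'a::banach"
  assumes ne: "\<And>n. s n \<noteq> t n" and le: "\<And>n. \<bar>s n\<bar> \<le> \<bar>t n\<bar>"
    and t: "t \<longlonglongrightarrow> 0"
    and w: "(\<lambda>n. w n /\<^sub>R (t n - s n)) \<longlonglongrightarrow> a"
  obtains G G' and r :: "nat \<Rightarrow> nat" where
    "\<And>z. (G has_vector_derivative G' z) (at z)" "continuous_on UNIV G'"
    "strict_mono r" "\<And>k. G (t (r k)) - G (s (r k)) = w (r k)"
proof -
  \<comment> \<open>Since \<open>\<bar>s n\<bar> \<le> \<bar>t n\<bar>\<close>, this is the least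
    nonzero absolute value among the two points. The point 0 is left out because the pairs
    accumulate there; \<open>z0\<close> below treats it separately.\<close>
  define m where "m n = (if s n = 0 then \<bar>t n\<bar> else \<bar>s n\<bar>)" for n
  have t0: "t n \<noteq> 0" for n using ne[of n] le[of n] by auto
  have m: "m n > 0" "m n \<le> \<bar>t n\<bar>" for n using t0[of n] le[of n] by (auto simp: m_def)
  \<comment> \<open>The part of the increment that the linear map \<open>z *\<^sub>R a\<close>
    misses, to be supplied by a bump. It is small compared with \<open>t n - s n\<close>.\<close>
  define d where "d n = w n - (t n - s n) *\<^sub>R a" for n
  have d: "(\<lambda>n. norm (d n) / \<bar>t n - s n\<bar>) \<longlonglongrightarrow> 0"
  proof -
    have "(\<lambda>n. norm (w n /\<^sub>R (t n - s n) - a)) \<longlonglongrightarrow> 0"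
      using tendsto_norm[OF tendsto_diff[OF w tendsto_const[of a]]] by simp
    moreover have "norm (w n /\<^sub>R (t n - s n) - a) = norm (d n) / \<bar>t n - s n\<bar>" for n
    proof -
      have "w n /\<^sub>R (t n - s n) - a = d n /\<^sub>R (t n - s n)"
        using ne[of n] by (simp add: d_def scaleR_diff_right)
      then show ?thesis by (simp add: divide_inverse mult.commute)
    qed
    ultimately show ?thesis by simp
  qed
  \<comment> \<open>The bound by \<open>m n / 2\<close> separates each pair from the earlier ones.
    The divisor 4 compensates for the radius \<open>\<rho>\<close>, which is a quarter of the
    distance between the two points.\<close>
  have step: "\<exists>n'. n < n' \<and> \<bar>t n'\<bar> < m n / 2 \<and> norm (d n') / \<bar>t n' - s n'\<bar> < (1/2) ^ k / 4" for n k
  proof -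
    have "\<forall>\<^sub>F n' in sequentially. \<bar>t n'\<bar> < m n / 2"
      using order_tendstoD(2)[OF tendsto_rabs_zero[OF t], of "m n / 2"] m(1)[of n] by simp
    moreover have "\<forall>\<^sub>F n' in sequentially. norm (d n') / \<bar>t n' - s n'\<bar> < (1/2) ^ k / 4"
      using order_tendstoD(2)[OF d, of "(1/2) ^ k / 4"] by simp
    moreover have "\<forall>\<^sub>F n' in sequentially. n < n'" by (rule eventually_gt_at_top)
    ultimately have "\<forall>\<^sub>F n' in sequentially. n < n' \<and> \<bar>t n'\<bar> < m n / 2 \<and>
        norm (d n') / \<bar>t n' - s n'\<bar> < (1/2) ^ k / 4"
      by eventually_elim simp
    then show ?thesis by (rule eventually_happens'[OF sequentially_bot])
  qed
  obtain r where r: "\<And>k. norm (d (r k)) / \<bar>t (r k) - s (r k)\<bar> < (1/2) ^ k / 4"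
      "\<And>k. r k < r (Suc k)" "\<And>k. \<bar>t (r (Suc k))\<bar> < m (r k) / 2"
    using dependent_nat_choice[where P = "\<lambda>k n. norm (d n) / \<bar>t n - s n\<bar> < (1/2) ^ k / 4"
        and Q = "\<lambda>k n n'. n < n' \<and> \<bar>t n'\<bar> < m n / 2"] step
    by metis
  have sm: "strict_mono r" using r(2) by (simp add: strict_mono_Suc_iff)
  have far: "\<bar>t (r j)\<bar> < m (r k) / 2" if "k < j" for k j
    using that
  proof (induction j rule: less_Suc_induct)
    case (1 i) then show ?case by (rule r(3))
  next
    case (2 i j k) then show ?case using m[of "r j"] by linarith
  qed
  \<comment> \<open>This radius is below the distance from \<open>t (r k)\<close> to
    \<open>s (r k)\<close>, and at most half the distance from \<open>t (r k)\<close> to 0, since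
    \<open>\<bar>s (r k)\<bar> \<le> \<bar>t (r k)\<bar>\<close>. So the bump vanishes at both of
    these points.\<close>
  define \<rho> where "\<rho> k = \<bar>t (r k) - s (r k)\<bar> / 4" for k
  have \<rho>: "\<rho> k > 0" for k using ne[of "r k"] by (simp add: \<rho>_def)
  have \<rho>le: "\<rho> k \<le> \<bar>t (r k)\<bar> / 2" for k using le[of "r k"] by (simp add: \<rho>_def)
  have z0: "bump (t (r k)) (\<rho> k) 0 = 0" for k
    by (rule bump_eq_0) (use \<rho>[of k] \<rho>le[of k] t0[of "r k"] in auto)
  have other: "bump (t (r j)) (\<rho> j) z = 0" if "z \<in> {s (r k), t (r k)}" "j \<noteq> k" for z j k
  proof (cases "z = 0")
    case True then show ?thesis using z0 by simp
  next
    case False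
    show ?thesis
    proof (rule bump_eq_0[OF \<rho>])
      have z: "\<bar>z\<bar> \<le> \<bar>t (r k)\<bar>" "m (r k) \<le> \<bar>z\<bar>"
        using that(1) le[of "r k"] m(2)[of "r k"] False by (auto simp: m_def)
      \<comment> \<open>One of \<open>z\<close> and \<open>t (r j)\<close> is less than half as far
        from 0 as the other: \<open>t (r j)\<close> if \<open>k < j\<close>, and \<open>z\<close> if
        \<open>j < k\<close>. Either way their distance exceeds half of
        \<open>\<bar>t (r j)\<bar>\<close>.\<close>
      show "\<rho> j \<le> \<bar>z - t (r j)\<bar>"
      proof (cases "k < j")
        case True
        show ?thesis using far[OF True] z \<rho>le[of j] by linarith
      next
        case False
        then have "j < k" using that(2) by simp
        from far[OF this] show ?thesis using z \<rho>le[of j] m(2)[of "r j"] by linarith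
      qed
    qed
  qed
  obtain g g' where g: "\<And>z. (\<lambda>k. bump (t (r k)) (\<rho> k) z *\<^sub>R d (r k)) sums g z"
    "\<And>z. (g has_vector_derivative g' z) (at z)" "continuous_on UNIV g'"
  proof (rule C1_scaled_bump_series[of \<rho> "\<lambda>k. d (r k)" "\<lambda>k. t (r k)" 0])
    show "norm (d (r k)) / \<rho> k \<le> (1/2) ^ k" for k
      using r(1)[of k] by (simp add: \<rho>_def)
  qed (use \<rho> z0 in auto)
  have gz: "g z = bump (t (r k)) (\<rho> k) z *\<^sub>R d (r k)" if "z \<in> {s (r k), t (r k)}" for z k
  proof -
    have "(\<lambda>j. bump (t (r j)) (\<rho> j) z *\<^sub>R d (r j)) sums (\<Sum>j\<in>{k}. bump (t (r j)) (\<rho> j) z *\<^sub>R d (r j))"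
      by (rule sums_finite) (use other[OF that] in auto)
    then show ?thesis using g(1)[of z] sums_unique2 by fastforce
  qed
  have "bump (t (r k)) (\<rho> k) (s (r k)) = 0" for k
    by (rule bump_eq_0[OF \<rho>]) (simp add: \<rho>_def abs_minus_commute)
  then have gd: "g (t (r k)) - g (s (r k)) = d (r k)" for k
    using gz[of "s (r k)" k] gz[of "t (r k)" k] by simp
  show ?thesis
  proof (rule that[of "\<lambda>z. z *\<^sub>R a + g z" "\<lambda>z. a + g' z" r])
    show "((\<lambda>z. z *\<^sub>R a + g z) has_vector_derivative a + g' z) (at z)" for z
      using g(2)[of z] by (auto intro!: derivative_eq_intros)
    show "continuous_on UNIV (\<lambda>z. a + g' z)"
      by (intro continuous_intros g(3))
    show "t (r k) *\<^sub>R a + g (t (r k)) - (s (r k) *\<^sub>R a + g (s (r k))) = w (r k)" for k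
      using gd[of k] by (simp add: d_def algebra_simps)
  qed (rule sm)
qed

text \<open>Exchanging \<open>s n\<close> with \<open>t n\<close> and changing the sign of
  \<open>w n\<close> alters neither the quotient nor the condition on the increment. So each pair
  can be ordered by absolute value.\<close>

lemma C1_interpolation:
  fixes s t :: "nat \<Rightarrow> real" and w :: "nat \<Rightarrow> 'a::banach"
  assumes ne: "\<And>n. s n \<noteq> t n"
    and s: "s \<longlonglongrightarrow> 0" and t: "t \<longlonglongrightarrow> 0"
    and w: "(\<lambda>n. w n /\<^sub>R (t n - s n)) \<longlonglongrightarrow> a"
  obtains G G' and r :: "nat \<Rightarrow> nat" where
    "\<And>z. (G has_vector_derivative G' z) (at z)" "continuous_on UNIV G'"
    "strict_mono r" "\<And>k. G (t (r k)) - G (s (r k)) = w (r k)"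
proof -
  define sw where "sw n \<longleftrightarrow> \<bar>t n\<bar> < \<bar>s n\<bar>" for n
  define s' where "s' n = (if sw n then t n else s n)" for n
  define t' where "t' n = (if sw n then s n else t n)" for n
  define w' where "w' n = (if sw n then - w n else w n)" for n
  have "(\<lambda>n. w' n /\<^sub>R (t' n - s' n)) = (\<lambda>n. w n /\<^sub>R (t n - s n))"
  proof
    fix n
    show "w' n /\<^sub>R (t' n - s' n) = w n /\<^sub>R (t n - s n)"
      using inverse_minus_eq[of "t n - s n"] by (simp add: w'_def t'_def s'_def)
  qed
  then have w': "(\<lambda>n. w' n /\<^sub>R (t' n - s' n)) \<longlonglongrightarrow> a"
    using w by simp
  have t': "t' \<longlonglongrightarrow> 0"
  proof (rule Lim_null_comparison)
    show "\<forall>\<^sub>F n in sequentially. norm (t' n) \<le> \<bar>s n\<bar> + \<bar>t n\<bar>"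
      by (simp add: t'_def)
    show "(\<lambda>n. \<bar>s n\<bar> + \<bar>t n\<bar>) \<longlonglongrightarrow> 0"
      using tendsto_add[OF tendsto_rabs_zero[OF s] tendsto_rabs_zero[OF t]] by simp
  qed
  have ne': "s' n \<noteq> t' n" and le': "\<bar>s' n\<bar> \<le> \<bar>t' n\<bar>" for n
    using ne[of n] by (auto simp: s'_def t'_def sw_def)
  show ?thesis
  proof (rule C1_interpolation_ordered[OF ne' le' t' w'])
    fix G G' and r :: "nat \<Rightarrow> nat"
    assume G: "\<And>z. (G has_vector_derivative G' z) (at z)" "continuous_on UNIV G'" "strict_mono r"
      and diff: "\<And>k. G (t' (r k)) - G (s' (r k)) = w' (r k)"
    have "G (t (r k)) - G (s (r k)) = w (r k)" for k
      using diff[of k] by (auto simp: s'_def t'_def w'_def algebra_simps split: if_splits)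
    then show thesis by (rule that[OF G])
  qed
qed

section \<open>Changes of charts of class \<open>C\<^sup>1\<close>\<close>

lemma Ck_on_1_iff:
  "Ck_on 1 S f \<longleftrightarrow> (\<forall>x\<in>S. f differentiable (at x)) \<and>
     (\<forall>v. continuous_on S (\<lambda>x. frechet_derivative f (at x) v))"
  by (simp add: One_nat_def)

lemma Ck_on_1_imp_continuous_on:
  assumes "Ck_on 1 S f" shows "continuous_on S f"
  using assms unfolding Ck_on_1_iff
  by (auto intro!: continuous_at_imp_continuous_on differentiable_imp_continuous_within)

lemma Ck_on_1_subset:
  assumes "Ck_on 1 T f" "S \<subseteq> T" shows "Ck_on 1 S f"
  using assms unfolding Ck_on_1_iff by (blast intro: continuous_on_subset)

text \<open>\<open>Ck_on\<close> uses derivatives at the points of \<open>S\<close>, not within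
  \<open>S\<close>; openness makes them depend on the values on \<open>S\<close> alone.\<close>

lemma Ck_on_1_cong:
  assumes "Ck_on 1 S f" "open S" "\<And>x. x \<in> S \<Longrightarrow> f x = g x"
  shows "Ck_on 1 S g"
proof -
  have diff: "f differentiable (at x)" if "x \<in> S" for x
    using assms(1) that unfolding Ck_on_1_iff by blast
  have eq: "frechet_derivative f (at x) = frechet_derivative g (at x)" if "x \<in> S" for x
    by (rule frechet_derivative_transform_within_open[OF diff assms(2)]) (use that assms(3) in auto)
  have "g differentiable (at x)" if "x \<in> S" for x
    using diff[OF that] that assms(2,3) unfolding differentiable_def
    by (meson has_derivative_transform_within_open)
  moreover have "continuous_on S (\<lambda>x. frechet_derivative g (at x) v)" for v
  proof -
    have "continuous_on S (\<lambda>x. frechet_derivative f (at x) v)"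
      using assms(1) unfolding Ck_on_1_iff by blast
    then show ?thesis by (rule continuous_on_eq) (simp add: eq)
  qed
  ultimately show ?thesis unfolding Ck_on_1_iff by blast
qed

text \<open>\<open>Ck_on\<close> gives continuity of the derivative of \<open>g\<close> only in a
  fixed direction, whereas the chain rule applies it in a direction that varies with
  \<open>x\<close>. Expanding that direction in the basis reduces to fixed ones.\<close>

lemma Ck_on_1_compose:
  fixes f :: "'a::real_normed_vector \<Rightarrow> 'b::euclidean_space"
    and g :: "'b \<Rightarrow> 'c::real_normed_vector"
  assumes f: "Ck_on 1 S f" and g: "Ck_on 1 T g" and sub: "f ` S \<subseteq> T"
  shows "Ck_on 1 S (g \<circ> f)"
proof -
  have df: "f differentiable (at x)" and dg: "g differentiable (at (f x))" if "x \<in> S" for x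
    using f g sub that unfolding Ck_on_1_iff by blast+
  have eq: "frechet_derivative (g \<circ> f) (at x) v =
      (\<Sum>i\<in>Basis. (frechet_derivative f (at x) v \<bullet> i) *\<^sub>R frechet_derivative g (at (f x)) i)"
    if "x \<in> S" for x v
  proof -
    have lin: "linear (frechet_derivative g (at (f x)))"
      by (rule linear_frechet_derivative[OF dg[OF that]])
    have "frechet_derivative (g \<circ> f) (at x) v =
        frechet_derivative g (at (f x)) (\<Sum>i\<in>Basis. (frechet_derivative f (at x) v \<bullet> i) *\<^sub>R i)"
      using frechet_derivative_compose[OF df[OF that] dg[OF that]] by (simp add: euclidean_representation)
    then show ?thesis
      by (simp add: linear_sum[OF lin] linear_cmul[OF lin])
  qed
  have "continuous_on S (\<lambda>x. frechet_derivative (g \<circ> f) (at x) v)" for v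
  proof -
    have "continuous_on S (\<lambda>x. frechet_derivative g (at (f x)) i)" for i
      by (rule continuous_on_compose2[OF _ Ck_on_1_imp_continuous_on[OF f] sub])
        (use g in \<open>simp add: Ck_on_1_iff\<close>)
    moreover have "continuous_on S (\<lambda>x. frechet_derivative f (at x) v)"
      using f by (simp add: Ck_on_1_iff)
    ultimately have "continuous_on S (\<lambda>x. \<Sum>i\<in>Basis.
        (frechet_derivative f (at x) v \<bullet> i) *\<^sub>R frechet_derivative g (at (f x)) i)"
      by (intro continuous_intros)
    then show ?thesis by (rule continuous_on_eq) (simp add: eq)
  qed
  moreover have "(g \<circ> f) differentiable (at x)" if "x \<in> S" for x
    using differentiable_chain_at[OF df[OF that] dg[OF that]] .
  ultimately show ?thesis unfolding Ck_on_1_iff by blast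
qed

text \<open>The translation depends only on the height of \<open>x\<close> over the hyperplane
  through \<open>x0\<close> with normal \<open>n\<close>. The shear with \<open>H\<close> and the
  one with \<open>- H\<close> later serve as a change of coordinates and its inverse.\<close>

lemma shear_has_derivative:
  fixes n x0 :: "'a::real_inner"
  assumes "\<And>z. (H has_vector_derivative H' z) (at z)"
  shows "((\<lambda>x. x + H ((x - x0) \<bullet> n)) has_derivative (\<lambda>h. h + (h \<bullet> n) *\<^sub>R H' ((x - x0) \<bullet> n))) (at x)"
proof -
  have "((\<lambda>x. (x - x0) \<bullet> n) has_derivative (\<lambda>h. h \<bullet> n)) (at x)"
    by (auto intro!: derivative_eq_intros)
  from has_derivative_compose[OF this assms[unfolded has_vector_derivative_def]]
  show ?thesis by (intro has_derivative_add has_derivative_ident)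
qed

lemma Ck_on_1_shear:
  fixes n x0 :: "'a::real_inner"
  assumes "\<And>z. (H has_vector_derivative H' z) (at z)" "continuous_on UNIV H'"
  shows "Ck_on 1 UNIV (\<lambda>x. x + H ((x - x0) \<bullet> n))"
proof -
  note D = shear_has_derivative[OF assms(1), of x0 n]
  have "continuous_on UNIV (\<lambda>x. v + (v \<bullet> n) *\<^sub>R H' ((x - x0) \<bullet> n))" for v
    by (intro continuous_intros continuous_on_compose2[OF assms(2)]) auto
  then show ?thesis
    unfolding Ck_on_1_iff frechet_derivative_at[OF D, symmetric]
    using D by (auto simp: differentiable_def)
qed

section \<open>Topology of charts and their composition with diffeomorphisms of Euclidean
  space\<close>

lemma top_chart_inj_on:
  assumes "top_chart X c" shows "inj_on (snd c) (fst c)"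
proof -
  have "fst c \<subseteq> topspace X" using assms openin_subset by (auto simp: top_chart_def)
  then show ?thesis
    using assms homeomorphic_imp_injective_map[of "subtopology X (fst c)" _ "snd c"]
    by (auto simp: top_chart_def Int_absorb1)
qed

lemma top_chart_open_image:
  assumes "top_chart X c" "openin X U" "U \<subseteq> fst c" shows "open (snd c ` U)"
proof -
  have "openin (subtopology X (fst c)) U"
    using assms openin_subset by (auto simp: openin_subtopology)
  then have "openin (top_of_set (snd c ` fst c)) (snd c ` U)"
    using assms homeomorphic_map_openness[of "subtopology X (fst c)" _ "snd c" U] openin_subset
    by (fastforce simp: top_chart_def)
  then show ?thesis
    using assms(1) openin_open_trans by (auto simp: top_chart_def)
qed

lemma top_chart_openin_vimage:
  assumes "top_chart X c" "open V" shows "openin X {q \<in> fst c. snd c q \<in> V}"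
proof -
  have "continuous_map (subtopology X (fst c)) euclidean (snd c)"
    using assms(1) homeomorphic_imp_continuous_map continuous_map_into_fulltopology
    by (fastforce simp: top_chart_def)
  moreover have "topspace (subtopology X (fst c)) = fst c"
    using assms(1) openin_subset by (auto simp: top_chart_def)
  ultimately have "openin (subtopology X (fst c)) {q \<in> fst c. snd c q \<in> V}"
    using openin_continuous_map_preimage[of "subtopology X (fst c)" euclidean "snd c" V] assms(2)
    by simp
  then show ?thesis
    using assms(1) openin_trans_full by (auto simp: top_chart_def)
qed

lemma top_chart_compose:
  assumes c: "top_chart X c"
    and cont: "continuous_on UNIV \<psi>" "continuous_on UNIV \<psi>'"
    and inv: "\<And>x. \<psi>' (\<psi> x) = x" "\<And>x. \<psi> (\<psi>' x) = x"
  shows "top_chart X (fst c, \<psi> \<circ> snd c)"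
proof -
  have "homeomorphic_maps euclidean euclidean \<psi> \<psi>'"
    using cont inv by (simp add: homeomorphic_maps_def)
  then have "homeomorphic_map (top_of_set (snd c ` fst c)) (top_of_set (\<psi> ` (snd c ` fst c))) \<psi>"
    by (intro homeomorphic_map_subtopologies) (auto simp: homeomorphic_map_maps)
  moreover have "homeomorphic_map (subtopology X (fst c)) (top_of_set (snd c ` fst c)) (snd c)"
    using c by (simp add: top_chart_def)
  ultimately have "homeomorphic_map (subtopology X (fst c)) (top_of_set (\<psi> ` (snd c ` fst c))) (\<psi> \<circ> snd c)"
    by (rule homeomorphic_map_compose[rotated])
  moreover have "open (\<psi> ` (snd c ` fst c))"
  proof -
    have "\<psi> ` (snd c ` fst c) = \<psi>' -` (snd c ` fst c)"
    proof (intro set_eqI iffI)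
      fix y assume "y \<in> \<psi>' -` (snd c ` fst c)"
      then have "\<psi> (\<psi>' y) \<in> \<psi> ` (snd c ` fst c)" by (intro imageI) simp
      then show "y \<in> \<psi> ` (snd c ` fst c)" by (simp only: inv)
    qed (auto simp: inv)
    then show ?thesis using c cont(2) by (simp add: open_vimage top_chart_def)
  qed
  ultimately show ?thesis
    using c by (simp add: top_chart_def image_comp)
qed

lemma chart_inv_chart:
  assumes "top_chart X c" "q \<in> fst c" shows "chart_inv c (snd c q) = q"
  unfolding chart_inv_def using top_chart_inj_on[OF assms(1)] assms(2) by (rule inv_into_f_f)

text \<open>The transitions of the new chart are those of \<open>c\<close> composed with
  \<open>\<psi>'\<close> on one side and \<open>\<psi>\<close> on the other. This produces the
  further charts in which the projection condition is tested.\<close>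

lemma C1_charts_at_compose:
  fixes \<psi> \<psi>' :: "real^3 \<Rightarrow> real^3"
  assumes A: "\<And>a. a \<in> A \<Longrightarrow> top_chart X a" and c: "c \<in> C1_charts_at X A p"
    and C1: "Ck_on 1 UNIV \<psi>" "Ck_on 1 UNIV \<psi>'"
    and inv: "\<And>x. \<psi>' (\<psi> x) = x" "\<And>x. \<psi> (\<psi>' x) = x"
  shows "(fst c, \<psi> \<circ> snd c) \<in> C1_charts_at X A p"
proof -
  define d where "d = (fst c, \<psi> \<circ> snd c)"
  have tc: "top_chart X c" and pc: "p \<in> fst c" and cc: "\<And>a. a \<in> A \<Longrightarrow> Ck_compatible 1 c a"
    using c by (auto simp: C1_charts_at_def C1_charts_def)
  have td: "top_chart X d"
    unfolding d_def
    by (rule top_chart_compose[OF tc Ck_on_1_imp_continuous_on[OF C1(1)]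
          Ck_on_1_imp_continuous_on[OF C1(2)] inv])
  have "Ck_compatible 1 d a" if a: "a \<in> A" for a
  proof -
    have ta: "top_chart X a" using A a by simp
    have op: "openin X (fst c \<inter> fst a)"
      using ta tc by (auto simp: top_chart_def)
    have "Ck_on 1 (snd d ` (fst d \<inter> fst a)) (transition c a \<circ> \<psi>')"
    proof (rule Ck_on_1_compose)
      show "Ck_on 1 (snd d ` (fst d \<inter> fst a)) \<psi>'" using C1(2) by (rule Ck_on_1_subset) simp
      show "Ck_on 1 (snd c ` (fst c \<inter> fst a)) (transition c a)"
        using cc[OF a] by (simp add: Ck_compatible_def)
    qed (auto simp: d_def inv)
    \<comment> \<open>The two maps need to agree only on the image of the overlap: elsewhere
      \<open>chart_inv\<close> can take arbitrary values. The opposite transition inverts only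
      \<open>a\<close>, so there the equality holds everywhere.\<close>
    then have "Ck_on 1 (snd d ` (fst d \<inter> fst a)) (transition d a)"
    proof (rule Ck_on_1_cong)
      show "open (snd d ` (fst d \<inter> fst a))"
        using top_chart_open_image[OF td] op by (simp add: d_def)
      show "(transition c a \<circ> \<psi>') x = transition d a x" if "x \<in> snd d ` (fst d \<inter> fst a)" for x
        using that chart_inv_chart[OF td] chart_inv_chart[OF tc]
        by (auto simp: transition_def d_def inv)
    qed
    moreover have "Ck_on 1 (snd a ` (fst c \<inter> fst a)) (\<psi> \<circ> transition a c)"
    proof (rule Ck_on_1_compose[OF _ C1(1)])
      show "Ck_on 1 (snd a ` (fst c \<inter> fst a)) (transition a c)"
        using cc[OF a] by (simp add: Ck_compatible_def)
    qed auto
    moreover have "\<psi> \<circ> transition a c = transition a d"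
      by (simp add: transition_def d_def comp_assoc)
    ultimately show ?thesis
      by (simp add: Ck_compatible_def d_def)
  qed
  with td pc show ?thesis
    by (simp add: C1_charts_at_def C1_charts_def d_def)
qed

text \<open>The transition from \<open>c\<close> to the new chart is \<open>\<psi>\<close> near
  \<open>snd c p\<close>, so the transformation law of tangent vectors is application of
  \<open>\<psi>'\<close>.\<close>

lemma plane_in_chart_compose:
  assumes plane: "plane_distribution X A \<xi>" and c: "c \<in> C1_charts_at X A p"
    and d: "(fst c, \<psi> \<circ> snd c) \<in> C1_charts_at X A p"
    and \<psi>: "(\<psi> has_derivative \<psi>') (at (snd c p))"
  shows "plane_in_chart \<xi> p (fst c, \<psi> \<circ> snd c) = \<psi>' ` plane_in_chart \<xi> p c"
proof -
  define d where "d = (fst c, \<psi> \<circ> snd c)"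
  have tc: "top_chart X c" and pc: "p \<in> fst c" using c by (auto simp: C1_charts_at_def C1_charts_def)
  then have "p \<in> topspace X" and oc: "openin X (fst c)"
    using openin_subset by (auto simp: top_chart_def)
  then have tangent: "\<xi> p \<subseteq> tangent_space X A p"
    using plane by (simp add: plane_distribution_def)
  have "(transition c d has_derivative \<psi>') (at (snd c p))"
  proof (rule has_derivative_transform_within_open[OF \<psi>])
    show "open (snd c ` fst c)" using tc by (simp add: top_chart_def)
    show "snd c p \<in> snd c ` fst c" using pc by simp
    show "\<psi> x = transition c d x" if "x \<in> snd c ` fst c" for x
      using that chart_inv_chart[OF tc] by (auto simp: transition_def d_def)
  qed
  then have D: "frechet_derivative (transition c d) (at (snd c p)) = \<psi>'"
    by (metis frechet_derivative_at)
  have "v d = \<psi>' (v c)" if "v \<in> \<xi> p" for v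
  proof -
    have "v d = frechet_derivative (transition c d) (at (snd c p)) (v c)"
      using tangent that c d by (auto simp: tangent_space_def d_def)
    then show ?thesis by (simp add: D)
  qed
  then show ?thesis
    unfolding plane_in_chart_def d_def[symmetric] image_image by (auto intro!: image_cong)
qed

section \<open>Projections and angles\<close>

text \<open>Uniqueness: the difference \<open>e\<close> of two candidates lies in the plane and is
  orthogonal to it, hence to itself.\<close>

lemma orth_proj_hyperplane:
  assumes "norm n = 1" shows "orth_proj {x. n \<bullet> x = 0} x = x - (n \<bullet> x) *\<^sub>R n"
  unfolding orth_proj_def
proof (rule the_equality)
  have n: "n \<bullet> n = 1" using assms by (simp add: dot_square_norm)
  show "x - (n \<bullet> x) *\<^sub>R n \<in> {x. n \<bullet> x = 0} \<and>
    (\<forall>z\<in>{x. n \<bullet> x = 0}. orthogonal (x - (x - (n \<bullet> x) *\<^sub>R n)) z)"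
    by (simp add: orthogonal_def inner_diff_right n)
  fix y assume y: "y \<in> {x. n \<bullet> x = 0} \<and> (\<forall>z\<in>{x. n \<bullet> x = 0}. orthogonal (x - y) z)"
  define e where "e = y - (x - (n \<bullet> x) *\<^sub>R n)"
  have e: "n \<bullet> e = 0" using y by (simp add: e_def inner_diff_right n)
  with y have "(x - y) \<bullet> e = 0" by (auto simp: orthogonal_def)
  moreover have "x - y = (n \<bullet> x) *\<^sub>R n - e" by (simp add: e_def)
  ultimately have "e \<bullet> e = 0" using e by (simp add: inner_diff_left)
  then show "y = x - (n \<bullet> x) *\<^sub>R n" by (simp add: e_def)
qed

lemma plane_unit_normal:
  assumes "subspace P" "dim P = 2"
  obtains n :: "real^3" where "norm n = 1" "P = {x. n \<bullet> x = 0}"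
proof -
  have "dim P = DIM(real^3) - 1" using assms(2) by simp
  then obtain a where a: "a \<noteq> 0" "span P = {x. a \<bullet> x = 0}" by (rule lowdim_eq_hyperplane)
  show ?thesis
    by (rule that[of "a /\<^sub>R norm a"]) (use a assms(1) in \<open>auto simp: span_eq_iff[THEN iffD2]\<close>)
qed

lemma plane_angle_orthogonal:
  assumes "\<And>w. w \<in> P \<Longrightarrow> u \<bullet> w = 0" "dim P \<noteq> 0"
  shows "plane_angle u P = pi / 2"
proof -
  \<comment> \<open>The infimum is over a constant family, so it has the constant value once the
    index set is nonempty.\<close>
  have "P - {0} \<noteq> {}" using assms(2) dim_eq_0[of P] by auto
  then show ?thesis
    unfolding plane_angle_def vec_angle_def using assms(1) by simp
qed

text \<open>The angle between \<open>u\<close> and its projection \<open>w\<close> has cosine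
  \<open>norm w / norm u\<close>, so \<open>norm w \<le> cos \<epsilon> * norm u\<close>, and
  Pythagoras turns this into a bound by the height \<open>n \<bullet> u\<close>. The sine in place
  of the tangent avoids dividing by a cosine that may be 0.\<close>

lemma sin_mult_norm_orth_proj_le:
  assumes n: "norm n = 1" and P: "P = {x. n \<bullet> x = 0}"
    and \<epsilon>: "\<epsilon> \<ge> 0" "\<epsilon> \<le> plane_angle u P"
  shows "sin \<epsilon> * norm (orth_proj P u) \<le> \<bar>n \<bullet> u\<bar>"
proof (cases "orth_proj P u = 0")
  case True then show ?thesis by simp
next
  case False
  define w where "w = orth_proj P u"
  have nn: "n \<bullet> n = 1" using n by (simp add: dot_square_norm)
  have w: "w = u - (n \<bullet> u) *\<^sub>R n" unfolding w_def P by (rule orth_proj_hyperplane[OF n])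
  have nw: "n \<bullet> w = 0" by (simp add: w inner_diff_right nn)
  have w0: "w \<noteq> 0" using False by (simp add: w_def)
  have uw: "u = w + (n \<bullet> u) *\<^sub>R n" by (simp add: w)
  have u_w: "u \<bullet> w = (norm w)\<^sup>2"
    by (subst uw) (simp add: inner_add_left nw dot_square_norm)
  have u_u: "(norm u)\<^sup>2 = (norm w)\<^sup>2 + (n \<bullet> u)\<^sup>2"
  proof -
    have "orthogonal w ((n \<bullet> u) *\<^sub>R n)"
      using nw by (simp add: orthogonal_def inner_commute)
    from norm_add_Pythagorean[OF this] show ?thesis
      unfolding uw[symmetric] by (simp add: n)
  qed
  have u0: "u \<noteq> 0"
  proof
    assume "u = 0" then show False using u_w w0 by simp
  qed
  define x where "x = norm w / norm u"
  have "norm w \<le> norm u" by (rule power2_le_imp_le) (simp_all add: u_u)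
  then have x: "0 \<le> x" "x \<le> 1" using u0 by (auto simp: x_def)
  have "vec_angle u w = arccos x"
    using w0 by (simp add: vec_angle_def u_w x_def power2_eq_square)
  moreover have "plane_angle u P \<le> vec_angle u w"
    unfolding plane_angle_def
  proof (rule cINF_lower)
    have "0 \<le> vec_angle u v" for v
      unfolding vec_angle_def
      using Cauchy_Schwarz_ineq2[of u v]
      by (intro arccos_lbound) (auto simp: divide_le_eq le_divide_eq mult_nonneg_nonneg split: if_splits)
    \<comment> \<open>Nonnegativity of angles makes the infimum a genuine lower bound, so it can be
      compared with its member at \<open>w\<close>.\<close>
    then show "bdd_below (vec_angle u ` (P - {0}))" by (intro bdd_belowI2[of _ 0]) 
    show "w \<in> P - {0}" using nw w0 by (simp add: P)
  qed
  ultimately have le: "\<epsilon> \<le> arccos x" using \<epsilon> by simp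
  have "cos (arccos x) \<le> cos \<epsilon>"
    by (rule cos_monotone_0_pi_le) (use \<epsilon> le x arccos_ubound in auto)
  then have "x \<le> cos \<epsilon>" using x by simp
  then have "norm w \<le> cos \<epsilon> * norm u" using u0 by (simp add: x_def divide_le_eq)
  then have "(norm w)\<^sup>2 \<le> (cos \<epsilon>)\<^sup>2 * (norm u)\<^sup>2"
    by (metis norm_ge_zero power_mono power_mult_distrib)
  then have "(sin \<epsilon> * norm w)\<^sup>2 \<le> (cos \<epsilon>)\<^sup>2 * (n \<bullet> u)\<^sup>2"
    unfolding u_u by (simp add: power_mult_distrib sin_squared_eq algebra_simps)
  also have "\<dots> \<le> (n \<bullet> u)\<^sup>2"
    by (simp add: mult_left_le_one_le power_le_one_iff abs_square_le_1)
  finally have "\<bar>sin \<epsilon> * norm w\<bar> \<le> \<bar>n \<bullet> u\<bar>"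
    by (rule abs_le_square_iff[THEN iffD2])
  then show ?thesis
    unfolding w_def by linarith
qed

section \<open>Equivalence of the two definitions\<close>

text \<open>Passing to a subsequence \<open>r\<close> of the given chords keeps their end points
  converging to \<open>p\<close>, so coincidences occur arbitrarily close to \<open>p\<close>. The
  domain is unchanged, so neighborhoods can be carried between the charts.\<close>

lemma chart_with_equal_projections:
  fixes x y :: "nat \<Rightarrow> 'm"
  assumes A: "\<And>a. a \<in> A \<Longrightarrow> top_chart X a" and plane: "plane_distribution X A \<xi>"
    and c: "c \<in> C1_charts_at X A p"
    and xy: "\<And>k. x k \<in> fst c" "\<And>k. y k \<in> fst c" "\<And>k. x k \<noteq> y k"
    and x: "(\<lambda>k. snd c (x k)) \<longlonglongrightarrow> snd c p" and y: "(\<lambda>k. snd c (y k)) \<longlonglongrightarrow> snd c p"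
    and \<epsilon>: "\<epsilon> > 0"
    and angle: "\<And>k. \<epsilon> \<le> plane_angle (snd c (y k) - snd c (x k)) (plane_in_chart \<xi> p c)"
  obtains d r where "d \<in> C1_charts_at X A p" "fst d = fst c" "strict_mono (r :: nat \<Rightarrow> nat)"
    "\<And>k. orth_proj (plane_in_chart \<xi> p d) (snd d (x (r k))) =
          orth_proj (plane_in_chart \<xi> p d) (snd d (y (r k)))"
proof -
  define P where "P = plane_in_chart \<xi> p c"
  have tc: "top_chart X c" and pc: "p \<in> fst c"
    using c by (auto simp: C1_charts_at_def C1_charts_def)
  then have "p \<in> topspace X" using openin_subset by (auto simp: top_chart_def)
  then have "subspace P" "dim P = 2"
    using plane c by (auto simp: plane_distribution_def P_def)
  then obtain n where n: "norm n = 1" and P: "P = {v. n \<bullet> v = 0}"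
    by (rule plane_unit_normal)
  have nn: "n \<bullet> n = 1" using n by (simp add: dot_square_norm)
  note proj = orth_proj_hyperplane[OF n, folded P]
  define x0 where "x0 = snd c p"
  \<comment> \<open>\<open>s\<close> and \<open>t\<close> are the heights of the end points relative
    to \<open>p\<close>; \<open>w\<close> is the horizontal displacement.\<close>
  define s where "s k = (snd c (x k) - x0) \<bullet> n" for k
  define t where "t k = (snd c (y k) - x0) \<bullet> n" for k
  define u where "u k = snd c (y k) - snd c (x k)" for k
  define w where "w k = orth_proj P (u k)" for k
  have ts: "t k - s k = n \<bullet> u k" for k
    by (simp add: t_def s_def u_def inner_diff_left inner_diff_right inner_commute)
  have u0: "u k \<noteq> 0" for k
    using xy[of k] inj_onD[OF top_chart_inj_on[OF tc]] by (auto simp: u_def)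
  \<comment> \<open>Truncation at 1 keeps the angle inside the interval where the sine is positive,
    however large \<open>\<epsilon>\<close> is.\<close>
  define \<eta> where "\<eta> = min \<epsilon> 1"
  have sin: "sin \<eta> > 0"
    by (rule sin_gt_zero) (use \<epsilon> pi_gt3 in \<open>auto simp: \<eta>_def min_def\<close>)
  have bound: "sin \<eta> * norm (w k) \<le> \<bar>t k - s k\<bar>" for k
    unfolding ts w_def
    by (rule sin_mult_norm_orth_proj_le[OF n P]) (use \<epsilon> angle[of k] in \<open>auto simp: \<eta>_def u_def P_def\<close>)
  \<comment> \<open>With equal heights the bound forces the horizontal displacement to vanish as
    well, so the chord would be 0.\<close>
  have ne: "s k \<noteq> t k" for k
  proof
    assume "s k = t k"
    then have nu: "n \<bullet> u k = 0" and "sin \<eta> * norm (w k) \<le> 0" using bound[of k] ts[of k] by auto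
    then have "w k = 0" using sin by (simp add: mult_le_0_iff)
    with nu u0[of k] show False by (simp add: w_def proj)
  qed
  have "w k /\<^sub>R (t k - s k) \<in> cball 0 (1 / sin \<eta>)" for k
    using bound[of k] sin ne[of k] by (simp add: field_simps)
  then obtain a r1 where r1: "strict_mono r1"
    and a: "((\<lambda>k. w k /\<^sub>R (t k - s k)) \<circ> r1) \<longlonglongrightarrow> a"
    using seq_compactE[OF compact_imp_seq_compact[OF compact_cball[of "0::real^3" "1 / sin \<eta>"]],
        of "\<lambda>k. w k /\<^sub>R (t k - s k)"] by blast
  have "s \<longlonglongrightarrow> 0" "t \<longlonglongrightarrow> 0"
    unfolding s_def[abs_def] t_def[abs_def] x0_def using x y by (auto intro!: tendsto_eq_intros)
  then have lims: "(s \<circ> r1) \<longlonglongrightarrow> 0" "(t \<circ> r1) \<longlonglongrightarrow> 0"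
    using LIMSEQ_subseq_LIMSEQ r1 by blast+
  show thesis
  proof (rule C1_interpolation[of "s \<circ> r1" "t \<circ> r1" "w \<circ> r1" a])
    show "(s \<circ> r1) k \<noteq> (t \<circ> r1) k" for k using ne by simp
    show "(\<lambda>k. (w \<circ> r1) k /\<^sub>R ((t \<circ> r1) k - (s \<circ> r1) k)) \<longlonglongrightarrow> a"
      using a by (simp add: comp_def)
    fix G G' and r2 :: "nat \<Rightarrow> nat"
    assume G: "\<And>z. (G has_vector_derivative G' z) (at z)" "continuous_on UNIV G'"
      and r2: "strict_mono r2"
      and diff: "\<And>k. G ((t \<circ> r1) (r2 k)) - G ((s \<circ> r1) (r2 k)) = (w \<circ> r1) (r2 k)"
    \<comment> \<open>\<open>G\<close> may have a component along \<open>n\<close>. Removing it does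
      not change the prescribed increments, because each \<open>w j\<close> lies in the
      plane.\<close>
    define H where "H z = G z - (n \<bullet> G z) *\<^sub>R n" for z
    define H' where "H' z = G' z - (n \<bullet> G' z) *\<^sub>R n" for z
    have H: "(H has_vector_derivative H' z) (at z)" "((\<lambda>z. - H z) has_vector_derivative - H' z) (at z)" for z
    proof -
      have "((\<lambda>z. n \<bullet> G z) has_real_derivative n \<bullet> G' z) (at z)"
        using bounded_linear.has_vector_derivative[OF bounded_linear_inner_right G(1)]
        by (simp add: has_real_derivative_iff_has_vector_derivative)
      with G(1)[of z] show "(H has_vector_derivative H' z) (at z)"
          "((\<lambda>z. - H z) has_vector_derivative - H' z) (at z)"
        unfolding H_def[abs_def] H'_def by (auto intro!: derivative_eq_intros)
    qed
    have H': "continuous_on UNIV H'" "continuous_on UNIV (\<lambda>z. - H' z)"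
      unfolding H'_def[abs_def] by (intro continuous_intros G(2))+
    have nH: "n \<bullet> H z = 0" for z by (simp add: H_def inner_diff_right nn)
    \<comment> \<open>Since \<open>H\<close> takes values in the plane, the shear below preserves the height
      \<open>(v - x0) \<bullet> n\<close>; this gives its inverse, and its differential fixes the plane pointwise.\<close>
    define \<psi> where "\<psi> v = v + - H ((v - x0) \<bullet> n)" for v
    define \<psi>' where "\<psi>' v = v + H ((v - x0) \<bullet> n)" for v
    have C1: "Ck_on 1 UNIV \<psi>" "Ck_on 1 UNIV \<psi>'"
      unfolding \<psi>_def[abs_def] \<psi>'_def[abs_def]
      by (rule Ck_on_1_shear[OF H(2) H'(2)], rule Ck_on_1_shear[OF H(1) H'(1)])
    have Hn: "H z \<bullet> n = 0" for z using nH by (simp add: inner_commute)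
    have inv: "\<psi>' (\<psi> v) = v" "\<psi> (\<psi>' v) = v" for v
      by (simp_all add: \<psi>_def \<psi>'_def inner_diff_left inner_add_left Hn)
    define d where "d = (fst c, \<psi> \<circ> snd c)"
    have d: "d \<in> C1_charts_at X A p"
      unfolding d_def by (rule C1_charts_at_compose[OF A c C1 inv])
    have D: "(\<psi> has_derivative (\<lambda>h. h + (h \<bullet> n) *\<^sub>R - H' ((snd c p - x0) \<bullet> n))) (at (snd c p))"
      unfolding \<psi>_def[abs_def] by (rule shear_has_derivative[OF H(2)])
    have "plane_in_chart \<xi> p d = (\<lambda>h. h + (h \<bullet> n) *\<^sub>R - H' ((snd c p - x0) \<bullet> n)) ` P"
      unfolding d_def P_def
      by (rule plane_in_chart_compose[OF plane c _ D]) (use d in \<open>simp add: d_def\<close>)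
    also have "\<dots> = P"
      by (auto simp: P inner_commute image_iff)
    finally have Pd: "plane_in_chart \<xi> p d = P" .
    show thesis
    proof (rule that[OF d])
      show "fst d = fst c" by (simp add: d_def)
      show "strict_mono (r1 \<circ> r2)" using r1 r2 by (rule strict_mono_o)
      fix k
      define j where "j = r1 (r2 k)"
      have G_eq: "G (t j) - G (s j) = w j" using diff[of k] by (simp add: j_def)
      have "H (t j) - H (s j) = w j - (n \<bullet> w j) *\<^sub>R n"
        unfolding H_def G_eq[symmetric] by (simp add: inner_diff_right algebra_simps)
      moreover have "n \<bullet> w j = 0" by (simp add: w_def proj inner_diff_right nn)
      ultimately have "H (t j) - H (s j) = u j - (n \<bullet> u j) *\<^sub>R n" by (simp add: w_def proj)
      moreover have "\<psi> (snd c (y j)) - \<psi> (snd c (x j)) = u j - (H (t j) - H (s j))"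
        by (simp add: \<psi>_def s_def t_def u_def)
      \<comment> \<open>The shear subtracts exactly the horizontal part of the chord and leaves its
        normal part.\<close>
      ultimately have "\<psi> (snd c (y j)) - \<psi> (snd c (x j)) = (n \<bullet> u j) *\<^sub>R n"
        by simp
      then have e: "\<psi> (snd c (y j)) = \<psi> (snd c (x j)) + (n \<bullet> u j) *\<^sub>R n"
        by (simp add: algebra_simps)
      have "orth_proj P (\<psi> (snd c (x j))) = orth_proj P (\<psi> (snd c (y j)))"
        unfolding proj e by (simp add: inner_add_right nn algebra_simps)
      then show "orth_proj (plane_in_chart \<xi> p d) (snd d (x ((r1 \<circ> r2) k))) =
          orth_proj (plane_in_chart \<xi> p d) (snd d (y ((r1 \<circ> r2) k)))"
        unfolding Pd by (simp add: d_def j_def)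
    qed
  qed (use lims in auto)
qed

text \<open>Equal projections make the difference a multiple of the unit normal, and then the angle
  is exactly \<open>pi / 2\<close>.\<close>

lemma inj_on_orth_proj_of_plane_angle:
  assumes "top_chart X c" "U \<subseteq> fst c" "subspace P" "dim P = 2"
    and angle: "\<And>p' p''. p' \<in> S \<inter> U \<Longrightarrow> p'' \<in> S \<inter> U \<Longrightarrow> p' \<noteq> p'' \<Longrightarrow>
      plane_angle (snd c p'' - snd c p') P < pi / 2"
  shows "inj_on (\<lambda>q. orth_proj P (snd c q)) (S \<inter> U)"
proof (rule inj_onI, rule ccontr)
  fix p' p'' assume p: "p' \<in> S \<inter> U" "p'' \<in> S \<inter> U" "p' \<noteq> p''"
    and eq: "orth_proj P (snd c p') = orth_proj P (snd c p'')"
  obtain n where n: "norm n = 1" and P: "P = {v. n \<bullet> v = 0}"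
    using assms(3,4) by (rule plane_unit_normal)
  have diff: "snd c p'' - snd c p' = (n \<bullet> (snd c p'' - snd c p')) *\<^sub>R n"
    using eq unfolding P orth_proj_hyperplane[OF n] by (simp add: algebra_simps)
  have "(snd c p'' - snd c p') \<bullet> w = 0" if "w \<in> P" for w
    by (subst diff) (use that in \<open>simp add: P\<close>)
  then have "plane_angle (snd c p'' - snd c p') P = pi / 2"
    by (rule plane_angle_orthogonal) (use assms(4) in auto)
  with angle[OF p] show False by simp
qed

text \<open>The quantifier over charts stays inside each side: the angle condition in
  \<open>c\<close> is obtained from the projection condition in another chart, built from the chords
  that would violate it.\<close>

lemma proj_iff_angle_at:
  fixes L :: "real \<Rightarrow> 'm set"
  assumes A: "\<And>a. a \<in> A \<Longrightarrow> top_chart X a" and plane: "plane_distribution X A \<xi>"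
    and t0: "t0 \<in> {0..1}"
  shows "(\<forall>c \<in> C1_charts_at X A p. \<exists>U I. openin X U \<and> p \<in> U \<and> U \<subseteq> fst c \<and> nbhd_interval t0 I \<and>
          (\<forall>t\<in>I. inj_on (\<lambda>q. orth_proj (plane_in_chart \<xi> p c) (snd c q)) (L t \<inter> U))) \<longleftrightarrow>
    (\<forall>c \<in> C1_charts_at X A p. \<forall>\<epsilon>>0. \<exists>U I. openin X U \<and> p \<in> U \<and> U \<subseteq> fst c \<and> nbhd_interval t0 I \<and>
          (\<forall>t\<in>I. \<forall>p' \<in> L t \<inter> U. \<forall>p'' \<in> L t \<inter> U. p' \<noteq> p'' \<longrightarrow>
             plane_angle (snd c p'' - snd c p') (plane_in_chart \<xi> p c) < \<epsilon>))"
    (is "?proj \<longleftrightarrow> ?angle")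
proof
  assume angle: ?angle
  show ?proj
  proof
    fix c assume c: "c \<in> C1_charts_at X A p"
    then have tc: "top_chart X c" and "p \<in> topspace X"
      using openin_subset by (auto simp: C1_charts_at_def C1_charts_def top_chart_def)
    then have P: "subspace (plane_in_chart \<xi> p c)" "dim (plane_in_chart \<xi> p c) = 2"
      using plane c by (auto simp: plane_distribution_def)
    obtain U I where U: "openin X U" "p \<in> U" "U \<subseteq> fst c" "nbhd_interval t0 I"
      and lt: "\<forall>t\<in>I. \<forall>p' \<in> L t \<inter> U. \<forall>p'' \<in> L t \<inter> U. p' \<noteq> p'' \<longrightarrow>
             plane_angle (snd c p'' - snd c p') (plane_in_chart \<xi> p c) < pi / 2"
      using angle[rule_format, OF c, of "pi / 2"] pi_gt_zero by auto
    have "inj_on (\<lambda>q. orth_proj (plane_in_chart \<xi> p c) (snd c q)) (L t \<inter> U)" if "t \<in> I" for t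
      by (rule inj_on_orth_proj_of_plane_angle[OF tc U(3) P]) (use lt that in blast)
    with U show "\<exists>U I. openin X U \<and> p \<in> U \<and> U \<subseteq> fst c \<and> nbhd_interval t0 I \<and>
          (\<forall>t\<in>I. inj_on (\<lambda>q. orth_proj (plane_in_chart \<xi> p c) (snd c q)) (L t \<inter> U))"
      by blast
  qed
next
  assume proj: ?proj
  show ?angle
  proof (intro ballI allI impI, rule ccontr)
    fix c and \<epsilon> :: real assume c: "c \<in> C1_charts_at X A p" and \<epsilon>: "\<epsilon> > 0"
      and no: "\<not> (\<exists>U I. openin X U \<and> p \<in> U \<and> U \<subseteq> fst c \<and> nbhd_interval t0 I \<and>
          (\<forall>t\<in>I. \<forall>p' \<in> L t \<inter> U. \<forall>p'' \<in> L t \<inter> U. p' \<noteq> p'' \<longrightarrow>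
             plane_angle (snd c p'' - snd c p') (plane_in_chart \<xi> p c) < \<epsilon>))"
    have tc: "top_chart X c" and pc: "p \<in> fst c"
      using c by (auto simp: C1_charts_at_def C1_charts_def)
    define \<delta> where "\<delta> k = inverse (real (Suc k))" for k
    have \<delta>: "\<delta> k > 0" for k by (simp add: \<delta>_def)
    have \<delta>0: "\<delta> \<longlonglongrightarrow> 0" unfolding \<delta>_def[abs_def] by (rule LIMSEQ_inverse_real_of_nat)
    define V where "V k = {q \<in> fst c. snd c q \<in> ball (snd c p) (\<delta> k)}" for k
    define J where "J k = {0..1} \<inter> ball t0 (\<delta> k)" for k
    \<comment> \<open>Failure of the angle condition is applied to a shrinking ball and a shrinking
      interval, so the parameters of the offending chords converge to \<open>t0\<close>.\<close>
    have "\<exists>t p' p''. t \<in> J k \<and> p' \<in> L t \<inter> V k \<and> p'' \<in> L t \<inter> V k \<and> p' \<noteq> p'' \<and>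
        \<epsilon> \<le> plane_angle (snd c p'' - snd c p') (plane_in_chart \<xi> p c)" for k
    proof -
      have "openin X (V k)"
        unfolding V_def by (rule top_chart_openin_vimage[OF tc open_ball])
      moreover have "p \<in> V k" "V k \<subseteq> fst c" using pc \<delta>[of k] by (auto simp: V_def)
      moreover have "nbhd_interval t0 (J k)"
        unfolding nbhd_interval_def J_def
        using t0 \<delta>[of k] openin_open_Int[OF open_ball, of "{0..1}" t0 "\<delta> k"]
        by (auto simp: is_interval_convex_1 intro!: convex_Int)
      ultimately show ?thesis using no by (meson not_less)
    qed
    then obtain t x y where txy: "\<And>k. t k \<in> J k" "\<And>k. x k \<in> L (t k) \<inter> V k" "\<And>k. y k \<in> L (t k) \<inter> V k"
      "\<And>k. x k \<noteq> y k"
      "\<And>k. \<epsilon> \<le> plane_angle (snd c (y k) - snd c (x k)) (plane_in_chart \<xi> p c)"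
      by metis
    have lim: "(\<lambda>k. snd c (q k)) \<longlonglongrightarrow> snd c p" if "\<And>k. q k \<in> V k" for q
      by (rule metric_tendsto_imp_tendsto[OF \<delta>0])
        (use that \<delta> in \<open>auto simp: V_def dist_commute less_imp_le intro!: always_eventually\<close>)
    have x: "(\<lambda>k. snd c (x k)) \<longlonglongrightarrow> snd c p" and y: "(\<lambda>k. snd c (y k)) \<longlonglongrightarrow> snd c p"
      using txy(2,3) by (auto intro: lim)
    have t: "t \<longlonglongrightarrow> t0"
      by (rule metric_tendsto_imp_tendsto[OF \<delta>0])
        (use txy(1) \<delta> in \<open>auto simp: J_def dist_commute less_imp_le intro!: always_eventually\<close>)
    obtain d r where d: "d \<in> C1_charts_at X A p" "fst d = fst c" and r: "strict_mono (r :: nat \<Rightarrow> nat)"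
      and eq: "\<And>k. orth_proj (plane_in_chart \<xi> p d) (snd d (x (r k))) =
          orth_proj (plane_in_chart \<xi> p d) (snd d (y (r k)))"
      by (rule chart_with_equal_projections[OF A plane c _ _ txy(4) x y \<epsilon> txy(5)])
        (use txy(2,3) in \<open>auto simp: V_def\<close>)
    obtain U I where U: "openin X U" "p \<in> U" "U \<subseteq> fst c" "nbhd_interval t0 I"
      and inj: "\<And>t. t \<in> I \<Longrightarrow> inj_on (\<lambda>q. orth_proj (plane_in_chart \<xi> p d) (snd d q)) (L t \<inter> U)"
      using proj d by metis
    \<comment> \<open>Convergence is known in coordinates only; openness of the image of
      \<open>U\<close> and injectivity of the chart bring it back to the manifold.\<close>
    have inU: "\<forall>\<^sub>F k in sequentially. q k \<in> U"
      if "(\<lambda>k. snd c (q k)) \<longlonglongrightarrow> snd c p" "\<And>k. q k \<in> V k" for q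
    proof -
      have "open (snd c ` U)" by (rule top_chart_open_image[OF tc U(1,3)])
      then have "\<forall>\<^sub>F k in sequentially. snd c (q k) \<in> snd c ` U"
        using that(1) U(2) by (auto dest: topological_tendstoD)
      then show ?thesis
      proof eventually_elim
        case (elim k)
        then show ?case
          using that(2)[of k] U(3) inj_on_image_mem_iff[OF top_chart_inj_on[OF tc]]
          by (auto simp: V_def)
      qed
    qed
    obtain W where W: "open W" "I = {0..1} \<inter> W"
      using U(4) by (auto simp: nbhd_interval_def openin_open)
    have "\<forall>\<^sub>F k in sequentially. t k \<in> W"
      using t W U(4) by (auto simp: nbhd_interval_def dest: topological_tendstoD)
    moreover have "\<forall>\<^sub>F k in sequentially. x k \<in> U" "\<forall>\<^sub>F k in sequentially. y k \<in> U"
      using txy(2,3) by (auto intro!: inU x y)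
    ultimately have "\<forall>\<^sub>F k in sequentially. t k \<in> W \<and> x k \<in> U \<and> y k \<in> U"
      by eventually_elim simp
    then have "\<forall>\<^sub>F k in sequentially. t (r k) \<in> W \<and> x (r k) \<in> U \<and> y (r k) \<in> U"
      using eventually_subseq[OF r] by blast
    \<comment> \<open>A late index puts both end points on the same curve inside \<open>U\<close>,
      with its parameter in \<open>I\<close>, while their projections in \<open>d\<close>
      coincide.\<close>
    then obtain k where k: "t (r k) \<in> W" "x (r k) \<in> U" "y (r k) \<in> U"
      using eventually_happens'[OF sequentially_bot] by blast
    then have "t (r k) \<in> I" using txy(1)[of "r k"] W by (auto simp: J_def)
    from inj_onD[OF inj[OF this] eq] have "x (r k) = y (r k)"
      using k txy(2,3)[of "r k"] by blast
    then show False using txy(4) by blast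
  qed
qed

section \<open>From the statement at a point to curves and isotopies\<close>

lemma nbhd_interval_unit: "t0 \<in> {0..1} \<Longrightarrow> nbhd_interval t0 {0..1}"
  by (simp add: nbhd_interval_def is_interval_cc)

lemma nbhd_interval_mem: "nbhd_interval t0 I \<Longrightarrow> t0 \<in> I"
  by (simp add: nbhd_interval_def)

lemma proj_legendrian_curve_iff_angle:
  assumes "\<And>a. a \<in> A \<Longrightarrow> top_chart X a" "plane_distribution X A \<xi>"
  shows "proj_legendrian_curve X A \<xi> L \<longleftrightarrow> angle_legendrian_curve X A \<xi> L"
proof -
  \<comment> \<open>A single curve is treated as a constant family at the parameter 0. The interval
    \<open>{0..1}\<close> serves in one direction; in the other, \<open>I\<close> contains 0, so the
    condition on \<open>U\<close> can be read off there.\<close>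
  have const: "(\<exists>U. openin X U \<and> p \<in> U \<and> U \<subseteq> S \<and> Q U) \<longleftrightarrow>
    (\<exists>U I. openin X U \<and> p \<in> U \<and> U \<subseteq> S \<and> nbhd_interval 0 I \<and> (\<forall>t\<in>I. Q U))" for p S Q
    using nbhd_interval_unit[of 0] nbhd_interval_mem[of 0] by fastforce
  show ?thesis
    unfolding proj_legendrian_curve_def angle_legendrian_curve_def const
    using proj_iff_angle_at[OF assms, of 0 _ "\<lambda>_. L"] by simp
qed

lemma proj_legendrian_isotopy_iff_angle:
  assumes "\<And>a. a \<in> A \<Longrightarrow> top_chart X a" "plane_distribution X A \<xi>"
  shows "proj_legendrian_isotopy X A \<xi> L \<longleftrightarrow> angle_legendrian_isotopy X A \<xi> L"
  unfolding proj_legendrian_isotopy_def angle_legendrian_isotopy_def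
  using proj_legendrian_curve_iff_angle[OF assms] proj_iff_angle_at[OF assms] by simp

theorem proposition7p2:
  fixes X :: "'m topology" and A :: "'m chart set" and \<xi> :: "'m \<Rightarrow> 'm tvec set"
  assumes "contact_3_manifold X A \<xi>"
  shows "(\<forall>L. embedded_curve X L \<longrightarrow>
            (proj_legendrian_curve X A \<xi> L \<longleftrightarrow> angle_legendrian_curve X A \<xi> L)) \<and>
         (\<forall>L. curve_isotopy X L \<longrightarrow>
            (proj_legendrian_isotopy X A \<xi> L \<longleftrightarrow> angle_legendrian_isotopy X A \<xi> L))"
proof -
  have A: "\<And>a. a \<in> A \<Longrightarrow> top_chart X a" and plane: "plane_distribution X A \<xi>"
    using assms
    by (auto simp: contact_3_manifold_def smooth_3_manifold_def contact_structure_def)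
  show ?thesis
    using proj_legendrian_curve_iff_angle[OF A plane] proj_legendrian_isotopy_iff_angle[OF A plane]
    by simp
qed

end
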